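(* For all non-negative integers $m$ and $n$, $$ \sum_{i,j}\left\vert j^2-i^2\right\vert \binom {2n}{n+i}\binom {2m}{m+j}\ge 2nm\binom {2n}n \binom {2m}m, $$ where the sum runs over all integers $i,j$, and equality holds if and only if $m=n$.
   Context: Binomial coefficients $\binom{N}{r}$ with $N\ge 0$ are zero unless $0\le r\le N$, so the sum is finite. *)

theory Defs
  imports Main "HOL-Library.Groups_Big_Fun"
begin

text \<open>
  Binomial coefficients with an integer lower index.  For \<open>r > int N\<close> the value is
  already zero by the convention for \<open>choose\<close>; only negative \<open>r\<close> needs a case of its own,
  since \<open>nat r = 0\<close> there.
\<close>

definition ichoose :: "nat \<Rightarrow> int \<Rightarrow> nat"  (infix \<open>ichoose\<close> 64)
  where "N ichoose r = (if r < 0 then 0 else N choose nat r)"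

text \<open>
  The sum over all pairs of integers is rendered by \<open>Sum_any\<close>, the sum over the support
  of a function, which is zero by convention if the support is infinite.  The following
  lemma shows that this convention never applies.
\<close>

lemma finite_support_ichoose:
  fixes w :: "int \<Rightarrow> int \<Rightarrow> int"
  shows "finite {(i, j). w i j * int (2 * n ichoose (int n + i))
                              * int (2 * m ichoose (int m + j)) \<noteq> 0}"
proof (rule finite_subset)
  show "{(i, j). w i j * int (2 * n ichoose (int n + i)) * int (2 * m ichoose (int m + j)) \<noteq> 0}
      \<subseteq> {- int n..int n} \<times> {- int m..int m}"
    by (auto simp: ichoose_def binomial_eq_0_iff split: if_splits)
qed simp

end

theory Submission
  imports Defs Complex_Main
begin

text \<open>
  Write \<open>b n i\<close> for the binomial coefficient of \<open>2 n\<close> over \<open>n + i\<close>, let \<open>F\<close> be the double sum and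
  let \<open>S(n, m)\<close> be the sum of \<open>sgn (j\<^sup>2 - i\<^sup>2) b n i b m j\<close>.
  The identity \<open>(m\<^sup>2 - j\<^sup>2) b m j = 2 m (2 m - 1) b (m - 1) j\<close> expresses \<open>F\<close> through \<open>S(n, m)\<close>,
  \<open>S(n, m - 1)\<close> and \<open>S(n - 1, m)\<close>. Pascal's rule applied twice and a summation by parts turn
  \<open>S(n, m) - 4 S(n, m - 1)\<close> into a sum with a second difference of the sign function, which
  lives next to \<open>j = \<plusminus>i\<close>; the remaining single sum telescopes. The outcome is
  \<open>F = P (2 m n + (m - n)\<^sup>2 / (2 (m + n))) + (m - n) / 2 S(n, m)\<close> with \<open>P = b n 0 b m 0\<close>,
  and \<open>S(n, m)\<close> has the sign of \<open>m - n\<close> because it is antisymmetric and the increments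
  \<open>S(n, m) - 4 S(n, m - 1)\<close> are positive.
\<close>

section \<open>Central binomial coefficients with integer offset\<close>

lemma ichoose_Suc: "Suc N ichoose r = (N ichoose r) + (N ichoose (r - 1))"
proof (cases "r \<le> 0")
  case True
  then show ?thesis by (cases "r = 0") (auto simp: ichoose_def)
next
  case False
  then obtain k where "r = int (Suc k)"
    by (metis not_le zero_less_imp_eq_int gr0_conv_Suc)
  then show ?thesis by (simp add: ichoose_def nat_add_distrib)
qed

lemma ichoose_absorb:
  "of_int r * real (Suc N ichoose r) = real (Suc N) * real (N ichoose (r - 1))"
proof (cases "r \<le> 0")
  case True
  then show ?thesis by (cases "r = 0") (auto simp: ichoose_def)
next
  case False
  then obtain k where r: "r = int (Suc k)"
    by (metis not_le zero_less_imp_eq_int gr0_conv_Suc)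
  have "real (Suc k * (Suc N choose Suc k)) = real (Suc N * (N choose k))"
    by (simp only: Suc_times_binomial)
  then show ?thesis by (simp add: r ichoose_def nat_add_distrib algebra_simps del: binomial_Suc_Suc)
qed

lemma ichoose_absorb_comp:
  "(real (Suc N) - of_int r) * real (Suc N ichoose r) = real (Suc N) * real (N ichoose r)"
  using ichoose_absorb[of r N] by (simp add: ichoose_Suc algebra_simps)

definition bc :: "nat \<Rightarrow> int \<Rightarrow> real"
  where "bc n i = real (2 * n ichoose (int n + i))"

lemma bc_eq_0: "bc n i = 0" if "\<bar>i\<bar> > int n"
  using that by (auto simp: bc_def ichoose_def binomial_eq_0_iff)

lemma bc_minus: "bc n (- i) = bc n i"
proof (cases "\<bar>i\<bar> > int n")
  case True
  then show ?thesis by (simp add: bc_eq_0)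
next
  case False
  then have "nat (int n - i) = 2 * n - nat (int n + i)" "nat (int n + i) \<le> 2 * n" by auto
  with False show ?thesis
    by (auto simp: bc_def ichoose_def binomial_symmetric[of "nat (int n + i)" "2 * n"])
qed

lemma bc_0: "bc n 0 = real (2 * n choose n)"
  by (simp add: bc_def ichoose_def)

lemma bc_0_pos: "bc n 0 > 0"
  by (simp add: bc_0)

lemma bc_pascal: "bc (Suc m) j = bc m (j + 1) + 2 * bc m j + bc m (j - 1)"
  by (simp add: bc_def ichoose_Suc algebra_simps)

text \<open>The ratio of neighbouring coefficients, cross-multiplied so that it survives where they
  vanish.\<close>

lemma bc_quotient: "(real m + of_int i + 1) * bc m (i + 1) = (real m - of_int i) * bc m i"
  using ichoose_absorb[of "int m + i + 1" "2 * m"]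
  by (simp add: bc_def ichoose_Suc algebra_simps)

text \<open>Absorbing \<open>m + 1 - j\<close> and then \<open>m + 1 + j\<close> lowers the upper
  index from \<open>2 m + 2\<close> to \<open>2 m + 1\<close> to \<open>2 m\<close>.\<close>

lemma bc_Suc_minus_square:
  "((real m + 1)\<^sup>2 - (of_int j)\<^sup>2) * bc (Suc m) j = 2 * (real m + 1) * (2 * real m + 1) * bc m j"
proof -
  have 1: "(real m + 1 - of_int j) * bc (Suc m) j
      = 2 * (real m + 1) * real (Suc (2 * m) ichoose (int m + 1 + j))"
    using ichoose_absorb_comp[of "Suc (2 * m)" "int m + 1 + j"]
    by (simp add: bc_def algebra_simps)
  have 2: "(real m + 1 + of_int j) * real (Suc (2 * m) ichoose (int m + 1 + j))
      = (2 * real m + 1) * bc m j"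
    using ichoose_absorb[of "int m + 1 + j" "2 * m"]
    by (simp add: bc_def algebra_simps)
  have "((real m + 1)\<^sup>2 - (of_int j)\<^sup>2) * bc (Suc m) j
      = (real m + 1 + of_int j) * ((real m + 1 - of_int j) * bc (Suc m) j)"
    by (simp add: power2_eq_square algebra_simps)
  also have "\<dots> = 2 * (real m + 1) *
      ((real m + 1 + of_int j) * real (Suc (2 * m) ichoose (int m + 1 + j)))"
    unfolding 1 by (simp only: mult_ac)
  finally show ?thesis by (simp only: 2 mult.assoc)
qed

text \<open>Absorption with the factors \<open>m + 1 + i\<close> and \<open>m + 1 - i\<close> leads
  to two neighbours in row \<open>2 m + 1\<close>; in their difference Pascal's rule cancels
  \<open>bc m i\<close>.\<close>

lemma bc_diff: "(real m + 1) * (bc m (i - 1) - bc m (i + 1)) = of_int i * bc (Suc m) i"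
proof -
  have "(real m + 1 + of_int i) * bc (Suc m) i
      = 2 * (real m + 1) * real (Suc (2 * m) ichoose (int m + i))"
    using ichoose_absorb[of "int m + 1 + i" "Suc (2 * m)"]
    by (simp add: bc_def algebra_simps)
  moreover have "(real m + 1 - of_int i) * bc (Suc m) i
      = 2 * (real m + 1) * real (Suc (2 * m) ichoose (int m + 1 + i))"
    using ichoose_absorb_comp[of "Suc (2 * m)" "int m + 1 + i"]
    by (simp add: bc_def algebra_simps)
  moreover have "real (Suc (2 * m) ichoose (int m + i)) = bc m i + bc m (i - 1)"
      "real (Suc (2 * m) ichoose (int m + 1 + i)) = bc m (i + 1) + bc m i"
    by (simp_all add: bc_def ichoose_Suc algebra_simps)
  ultimately show ?thesis by (simp add: algebra_simps)
qed

lemma square_times_bc: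
  "(of_int j)\<^sup>2 * bc m j = (real m)\<^sup>2 * bc m j - 2 * real m * (2 * real m - 1) * bc (m - 1) j"
proof (cases m)
  \<comment> \<open>The truncated \<open>m - 1\<close> is harmless because its term has the factor
    \<open>m\<close>.\<close>
  case 0
  then show ?thesis by (cases "j = 0") (auto simp: bc_eq_0)
next
  case (Suc k)
  then show ?thesis using bc_Suc_minus_square[of k j] by (simp add: algebra_simps)
qed

section \<open>Symmetric windows and a telescoping single sum\<close>

lemma sum_symmetric_Suc:
  fixes f :: "int \<Rightarrow> 'a::comm_monoid_add"
  shows "sum f {- int (Suc N)..int (Suc N)} = sum f {- int N..int N} + f (int N + 1) + f (- int N - 1)"
proof -
  have "{- int (Suc N)..int (Suc N)} = insert (int N + 1) (insert (- int N - 1) {- int N..int N})"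
    by auto
  then show ?thesis by (simp add: add_ac)
qed

text \<open>With \<open>T k = (k + m) (k + n) bc n k bc m k\<close>, \<open>bc_quotient\<close>
  gives \<open>T k - T (k + 1) = 2 k (m + n) bc n k bc m k\<close>, the contribution of
  \<open>i = k\<close> and \<open>i = - k\<close> together.\<close>

lemma sum_abs_bc_bc_partial:
  "real (m + n) * (\<Sum>i\<in>{- int N..int N}. \<bar>of_int i\<bar> * bc n i * bc m i)
     = real m * real n * bc n 0 * bc m 0
       - (real N + 1 + real m) * (real N + 1 + real n) * bc n (int N + 1) * bc m (int N + 1)"
proof (induction N)
  case 0
  have "(real n + 1) * bc n 1 = real n * bc n 0" "(real m + 1) * bc m 1 = real m * bc m 0"
    using bc_quotient[of n 0] bc_quotient[of m 0] by simp_all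
  then have "((real n + 1) * bc n 1) * ((real m + 1) * bc m 1) = real n * bc n 0 * (real m * bc m 0)"
    by simp
  then show ?case by (simp add: algebra_simps)
next
  case (Suc N)
  let ?k = "int N + 1"
  have minus: "bc l (- int N - 1) = bc l ?k" for l
    using bc_minus[of l ?k] by simp
  have step: "(real N + 2 + real l) * bc l (?k + 1) = (real l - (real N + 1)) * bc l ?k" for l
    using bc_quotient[of l ?k] by (simp add: algebra_simps)
  have "(real N + 2 + real m) * (real N + 2 + real n) * bc n (?k + 1) * bc m (?k + 1)
      = ((real N + 2 + real n) * bc n (?k + 1)) * ((real N + 2 + real m) * bc m (?k + 1))"
    by (simp only: mult_ac)
  also have "\<dots> = (real n - (real N + 1)) * (real m - (real N + 1)) * bc n ?k * bc m ?k"
    unfolding step by (simp only: mult_ac)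
  finally have next_boundary:
    "(real (Suc N) + 1 + real m) * (real (Suc N) + 1 + real n) * bc n (int (Suc N) + 1) * bc m (int (Suc N) + 1)
      = (real n - (real N + 1)) * (real m - (real N + 1)) * bc n ?k * bc m ?k"
    by (simp add: add_ac)
  have "real (m + n) * (\<Sum>i\<in>{- int (Suc N)..int (Suc N)}. \<bar>of_int i\<bar> * bc n i * bc m i)
      = real (m + n) * (\<Sum>i\<in>{- int N..int N}. \<bar>of_int i\<bar> * bc n i * bc m i)
        + real (m + n) * (2 * (real N + 1) * bc n ?k * bc m ?k)"
    unfolding sum_symmetric_Suc by (simp add: minus algebra_simps)
  then show ?case
    unfolding next_boundary Suc.IH by (simp add: algebra_simps)
qed

lemma sum_abs_bc_bc:
  assumes "n \<le> N"
  shows "real (m + n) * (\<Sum>i\<in>{- int N..int N}. \<bar>of_int i\<bar> * bc n i * bc m i)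
     = real m * real n * bc n 0 * bc m 0"
  using sum_abs_bc_bc_partial[of m n N] bc_eq_0[of n "int N + 1"] assms by simp

section \<open>The sign sum\<close>

text \<open>Summation by parts. The bound \<open>m < N\<close> is strict because the shifted window
  loses the end point \<open>- int N\<close> or \<open>int N\<close>, where \<open>bc m\<close> must
  vanish.\<close>

lemma sum_shift_bc:
  fixes f :: "int \<Rightarrow> real"
  assumes "m < N"
  shows "(\<Sum>j\<in>{- int N..int N}. f j * bc m (j + 1)) = (\<Sum>j\<in>{- int N..int N}. f (j - 1) * bc m j)"
    and "(\<Sum>j\<in>{- int N..int N}. f j * bc m (j - 1)) = (\<Sum>j\<in>{- int N..int N}. f (j + 1) * bc m j)"
proof -
  have "(\<Sum>j\<in>{- int N..int N}. f j * bc m (j + 1)) = (\<Sum>j\<in>{- int N + 1..int N + 1}. f (j - 1) * bc m j)"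
    by (rule sum.reindex_bij_witness[of _ "\<lambda>j. j - 1" "\<lambda>j. j + 1"]) auto
  also have "\<dots> = (\<Sum>j\<in>{- int N..int N}. f (j - 1) * bc m j)"
    by (rule sum.mono_neutral_cong) (use assms in \<open>auto intro: bc_eq_0\<close>)
  finally show "(\<Sum>j\<in>{- int N..int N}. f j * bc m (j + 1)) = (\<Sum>j\<in>{- int N..int N}. f (j - 1) * bc m j)" .
  have "(\<Sum>j\<in>{- int N..int N}. f j * bc m (j - 1)) = (\<Sum>j\<in>{- int N - 1..int N - 1}. f (j + 1) * bc m j)"
    by (rule sum.reindex_bij_witness[of _ "\<lambda>j. j + 1" "\<lambda>j. j - 1"]) auto
  also have "\<dots> = (\<Sum>j\<in>{- int N..int N}. f (j + 1) * bc m j)"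
    by (rule sum.mono_neutral_cong) (use assms in \<open>auto intro: bc_eq_0\<close>)
  finally show "(\<Sum>j\<in>{- int N..int N}. f j * bc m (j - 1)) = (\<Sum>j\<in>{- int N..int N}. f (j + 1) * bc m j)" .
qed

definition sg :: "int \<Rightarrow> int \<Rightarrow> real"
  where "sg i j = of_int (sgn (j\<^sup>2 - i\<^sup>2))"

lemma sg_eq: "sg i j = (if \<bar>i\<bar> < \<bar>j\<bar> then 1 else if \<bar>i\<bar> = \<bar>j\<bar> then 0 else - 1)"
proof -
  have "i\<^sup>2 < j\<^sup>2 \<longleftrightarrow> \<bar>i\<bar> < \<bar>j\<bar>" "i\<^sup>2 = j\<^sup>2 \<longleftrightarrow> \<bar>i\<bar> = \<bar>j\<bar>"
    using power2_le_iff_abs_le[of "\<bar>i\<bar>" j] abs_le_square_iff[of i j] abs_le_square_iff[of j i]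
    by (auto simp: power2_eq_iff abs_eq_iff)
  then show ?thesis by (auto simp: sg_def sgn_if)
qed

text \<open>For \<open>i \<noteq> 0\<close> the function \<open>sg i\<close> climbs or drops by two
  unit steps around \<open>j = i\<close> and \<open>j = - i\<close>; for \<open>i = 0\<close> it is
  constant 1 with a dip to 0 at the origin. Coinciding indicators, as for \<open>i = 1\<close> at
  \<open>j = 0\<close>, add up correctly.\<close>

lemma sg_second_diff:
  "sg i (j - 1) - 2 * sg i j + sg i (j + 1)
     = of_int (sgn i) * (of_bool (j = i - 1) - of_bool (j = i + 1)
                         - of_bool (j = - i - 1) + of_bool (j = - i + 1))
       + of_bool (i = 0) * (2 * of_bool (j = 0) - of_bool (j = 1) - of_bool (j = - 1))"
  by (cases i "0 :: int" rule: linorder_cases) (auto simp: sg_eq)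

lemma sum_of_bool_eq:
  fixes g :: "'a \<Rightarrow> real"
  assumes "finite A" "c \<notin> A \<Longrightarrow> g c = 0"
  shows "(\<Sum>j\<in>A. of_bool (j = c) * g j) = g c"
proof -
  have "(\<Sum>j\<in>A. of_bool (j = c) * g j) = (\<Sum>j\<in>A. if j = c then g j else 0)"
    by (intro sum.cong) auto
  then show ?thesis using assms by simp
qed

lemma sum_sg_bc_Suc:
  assumes "m < N"
  shows "(\<Sum>j\<in>{- int N..int N}. sg i j * bc (Suc m) j)
    = 4 * (\<Sum>j\<in>{- int N..int N}. sg i j * bc m j)
      + 2 * \<bar>of_int i\<bar> * bc (Suc m) i / (real m + 1)
      + of_bool (i = 0) * bc (Suc m) 0 / (2 * real m + 1)"
proof -
  let ?A = "{- int N..int N}"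
  \<comment> \<open>The point \<open>c\<close> may lie outside the window, but then
    \<open>bc m c = 0\<close>.\<close>
  have delta: "(\<Sum>j\<in>?A. of_bool (j = c) * bc m j) = bc m c" for c
    by (rule sum_of_bool_eq) (use assms in \<open>auto intro: bc_eq_0\<close>)
  have "(\<Sum>j\<in>?A. sg i j * bc (Suc m) j)
      = (\<Sum>j\<in>?A. sg i j * bc m (j + 1)) + 2 * (\<Sum>j\<in>?A. sg i j * bc m j)
        + (\<Sum>j\<in>?A. sg i j * bc m (j - 1))"
    by (simp add: bc_pascal algebra_simps sum.distrib sum_distrib_left)
  also have "\<dots> = 4 * (\<Sum>j\<in>?A. sg i j * bc m j)
      + (\<Sum>j\<in>?A. (sg i (j - 1) - 2 * sg i j + sg i (j + 1)) * bc m j)"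
    unfolding sum_shift_bc[OF assms]
    by (simp add: algebra_simps sum.distrib sum_subtractf sum_distrib_left)
  also have "(\<Sum>j\<in>?A. (sg i (j - 1) - 2 * sg i j + sg i (j + 1)) * bc m j)
      = (\<Sum>j\<in>?A. of_int (sgn i) * (of_bool (j = i - 1) * bc m j) - of_int (sgn i) * (of_bool (j = i + 1) * bc m j)
          - of_int (sgn i) * (of_bool (j = - i - 1) * bc m j) + of_int (sgn i) * (of_bool (j = - i + 1) * bc m j)
          + (2 * of_bool (i = 0) * (of_bool (j = 0) * bc m j) - of_bool (i = 0) * (of_bool (j = 1) * bc m j)
             - of_bool (i = 0) * (of_bool (j = - 1) * bc m j)))"
    unfolding sg_second_diff by (intro sum.cong refl) (simp only: algebra_simps)
  also have "\<dots> = of_int (sgn i) * bc m (i - 1) - of_int (sgn i) * bc m (i + 1)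
      - of_int (sgn i) * bc m (- i - 1) + of_int (sgn i) * bc m (- i + 1)
      + (2 * of_bool (i = 0) * bc m 0 - of_bool (i = 0) * bc m 1 - of_bool (i = 0) * bc m (- 1))"
    unfolding sum.distrib sum_subtractf sum_distrib_left[symmetric] delta ..
  also have "\<dots> = 2 * of_int (sgn i) * (bc m (i - 1) - bc m (i + 1))
      + of_bool (i = 0) * (2 * (bc m 0 - bc m 1))"
  proof -
    have "bc m (- i - 1) = bc m (i + 1)" "bc m (- i + 1) = bc m (i - 1)" "bc m (- 1) = bc m 1"
      using bc_minus[of m "i + 1"] bc_minus[of m "i - 1"] bc_minus[of m 1] by simp_all
    then show ?thesis by (simp only: algebra_simps)
  qed
  also have "bc m (i - 1) - bc m (i + 1) = of_int i * bc (Suc m) i / (real m + 1)"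
    using bc_diff[of m i] by (simp add: field_simps)
  \<comment> \<open>Twice a Catalan number: both sides are expressed through \<open>bc m 0\<close>
    and a factor \<open>m + 1\<close> is cancelled.\<close>
  also have "2 * (bc m 0 - bc m 1) = bc (Suc m) 0 / (2 * real m + 1)"
  proof -
    have "(real m + 1) * ((real m + 1) * bc (Suc m) 0) = (real m + 1) * (2 * (2 * real m + 1) * bc m 0)"
      using bc_Suc_minus_square[of m 0] by (simp add: power2_eq_square algebra_simps)
    then have "(real m + 1) * bc (Suc m) 0 = 2 * (2 * real m + 1) * bc m 0"
      by (subst (asm) mult_cancel_left) auto
    moreover have "(real m + 1) * (bc m 0 - bc m 1) = bc m 0"
      using bc_quotient[of m 0] by (simp add: algebra_simps)
    ultimately have "(real m + 1) * bc (Suc m) 0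
        = 2 * (2 * real m + 1) * ((real m + 1) * (bc m 0 - bc m 1))"
      by simp
    then have "(real m + 1) * bc (Suc m) 0 = (real m + 1) * (2 * (bc m 0 - bc m 1) * (2 * real m + 1))"
      by (simp only: mult_ac)
    then have "bc (Suc m) 0 = 2 * (bc m 0 - bc m 1) * (2 * real m + 1)"
      by (subst (asm) mult_cancel_left) auto
    then show ?thesis by (subst nonzero_eq_divide_eq) auto
  qed
  also have "2 * of_int (sgn i) * (of_int i * bc (Suc m) i / (real m + 1))
      = 2 * \<bar>of_int i\<bar> * bc (Suc m) i / (real m + 1)"
    by (simp add: sgn_if)
  finally show ?thesis by simp
qed

text \<open>The cutoff \<open>N\<close> is irrelevant as soon as it is at least \<open>n\<close> and \<open>m\<close>.\<close>

definition sgn_sum :: "nat \<Rightarrow> nat \<Rightarrow> nat \<Rightarrow> real"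
  where "sgn_sum N n m = (\<Sum>i\<in>{- int N..int N}. \<Sum>j\<in>{- int N..int N}. sg i j * bc n i * bc m j)"

lemma sgn_sum_antisym: "sgn_sum N m n = - sgn_sum N n m"
proof -
  let ?A = "{- int N..int N}"
  have swap: "sg i j * bc m i * bc n j = - (sg j i * bc n j * bc m i)" for i j
    by (simp add: sg_eq)
  have "sgn_sum N m n = - (\<Sum>i\<in>?A. \<Sum>j\<in>?A. sg j i * bc n j * bc m i)"
    unfolding sgn_sum_def swap sum_negf ..
  also have "(\<Sum>i\<in>?A. \<Sum>j\<in>?A. sg j i * bc n j * bc m i) = sgn_sum N n m"
    unfolding sgn_sum_def by (rule sum.swap)
  finally show ?thesis .
qed

text \<open>Weighting the inner recursion by \<open>bc n i\<close> turns its
  \<open>\<bar>i\<bar>\<close> term into the telescoping sum; the \<open>i = 0\<close> term yields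
  \<open>1 / (2 m + 1)\<close>.\<close>

lemma sgn_sum_Suc:
  assumes "m < N" "n \<le> N"
  shows "sgn_sum N n (Suc m) = 4 * sgn_sum N n m
    + bc n 0 * bc (Suc m) 0 * (2 * real n / real (Suc m + n) + 1 / (2 * real m + 1))"
proof -
  let ?A = "{- int N..int N}"
  have factor: "sgn_sum N n k = (\<Sum>i\<in>?A. bc n i * (\<Sum>j\<in>?A. sg i j * bc k j))" for k
    by (simp add: sgn_sum_def sum_distrib_left mult_ac)
  have "sgn_sum N n (Suc m) = (\<Sum>i\<in>?A. 4 * (bc n i * (\<Sum>j\<in>?A. sg i j * bc m j))
      + 2 / (real m + 1) * (\<bar>of_int i\<bar> * bc n i * bc (Suc m) i)
      + of_bool (i = 0) * (bc n i * bc (Suc m) 0 / (2 * real m + 1)))"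
    unfolding factor sum_sg_bc_Suc[OF assms(1)] by (intro sum.cong refl) (simp add: algebra_simps)
  also have "\<dots> = 4 * sgn_sum N n m
      + 2 / (real m + 1) * (\<Sum>i\<in>?A. \<bar>of_int i\<bar> * bc n i * bc (Suc m) i)
      + bc n 0 * bc (Suc m) 0 / (2 * real m + 1)"
    unfolding sum.distrib sum_distrib_left[symmetric] factor
    by (subst sum_of_bool_eq) auto
  also have "(\<Sum>i\<in>?A. \<bar>of_int i\<bar> * bc n i * bc (Suc m) i)
      = real (Suc m) * real n * bc n 0 * bc (Suc m) 0 / real (Suc m + n)"
    using sum_abs_bc_bc[OF assms(2), of "Suc m"] by (subst nonzero_eq_divide_eq) (auto simp: mult_ac)
  also have "2 / (real m + 1) * \<dots> = bc n 0 * bc (Suc m) 0 * (2 * real n / real (Suc m + n))"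
    by (simp add: divide_simps)
  finally show ?thesis by (simp add: algebra_simps)
qed

text \<open>Induction upwards from \<open>m = n\<close>, where antisymmetry forces the value
  0.\<close>

lemma sgn_sum_nonneg:
  assumes "n \<le> m" "m \<le> N"
  shows "sgn_sum N n m \<ge> 0"
  using assms
proof (induction m rule: dec_induct)
  case base
  show ?case using sgn_sum_antisym[of N n n] by simp
next
  case (step m)
  have "0 \<le> bc n 0 * bc (Suc m) 0 * (2 * real n / real (Suc m + n) + 1 / (2 * real m + 1))"
    using bc_0_pos[of n] bc_0_pos[of "Suc m"] by (intro mult_nonneg_nonneg add_nonneg_nonneg) auto
  then show ?case using step by (subst sgn_sum_Suc) auto
qed

lemma diff_mult_sgn_sum_nonneg:
  assumes "n \<le> N" "m \<le> N"
  shows "(real m - real n) * sgn_sum N n m \<ge> 0"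
proof (cases "n \<le> m")
  case True
  then show ?thesis using sgn_sum_nonneg[of n m N] assms by simp
next
  case False
  then show ?thesis using sgn_sum_nonneg[of m n N] sgn_sum_antisym[of N n m] assms
    by (intro mult_nonpos_nonpos) auto
qed

text \<open>\<open>sgn_sum_Suc\<close> solved for its lower term, scaled by the coefficient with
  which that term enters the absolute value sum.\<close>

lemma sgn_sum_pred:
  assumes "m \<le> N" "n \<le> N"
  shows "2 * real m * (2 * real m - 1) * sgn_sum N n (m - 1)
    = real m * (2 * real m - 1) / 2 * sgn_sum N n m
      - bc n 0 * bc m 0 * (real m * real n * (2 * real m - 1) / real (m + n) + real m / 2)"
proof (cases m)
  case 0
  then show ?thesis by simp
next
  case (Suc k)
  let ?q = "2 * real n / real (m + n) + 1 / (2 * real m - 1)"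
  have "real m * real n * (2 * real m - 1) / real (m + n) + real m / 2
      = real m * (2 * real m - 1) / 2 * ?q"
    using Suc by (simp add: divide_simps) (simp add: algebra_simps)
  moreover have "sgn_sum N n m = 4 * sgn_sum N n (m - 1) + bc n 0 * bc m 0 * ?q"
    using sgn_sum_Suc[of k N n] assms Suc by simp
  \<comment> \<open>Stated for arbitrary reals, so that the final rewriting treats the sign sums and
    \<open>?q\<close> as atoms.\<close>
  moreover have "c * x = c / 4 * (4 * x + p * q) - p * (c / 4 * q)" for c x p q :: real
    by (simp add: algebra_simps)
  from this[of "2 * real m * (2 * real m - 1)"] have
    "2 * real m * (2 * real m - 1) * x = real m * (2 * real m - 1) / 2 * (4 * x + p * q)
      - p * (real m * (2 * real m - 1) / 2 * q)" for x p q :: real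
    by simp
  ultimately show ?thesis by (simp only:)
qed

section \<open>The absolute value sum\<close>

definition abs_sum :: "nat \<Rightarrow> nat \<Rightarrow> nat \<Rightarrow> real"
  where "abs_sum N n m = (\<Sum>i\<in>{- int N..int N}. \<Sum>j\<in>{- int N..int N}.
           of_int \<bar>j\<^sup>2 - i\<^sup>2\<bar> * bc n i * bc m j)"

text \<open>The absolute value is \<open>sg i j\<close> times \<open>j\<^sup>2 - i\<^sup>2\<close>,
  and \<open>square_times_bc\<close> removes each square.\<close>

lemma abs_sum_eq_sgn_sums:
  "abs_sum N n m = ((real m)\<^sup>2 - (real n)\<^sup>2) * sgn_sum N n m
     - 2 * real m * (2 * real m - 1) * sgn_sum N n (m - 1)
     + 2 * real n * (2 * real n - 1) * sgn_sum N (n - 1) m"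
proof -
  have "of_int \<bar>j\<^sup>2 - i\<^sup>2\<bar> * bc n i * bc m j
      = ((real m)\<^sup>2 - (real n)\<^sup>2) * (sg i j * bc n i * bc m j)
        - 2 * real m * (2 * real m - 1) * (sg i j * bc n i * bc (m - 1) j)
        + 2 * real n * (2 * real n - 1) * (sg i j * bc (n - 1) i * bc m j)" for i j
  proof -
    have abs_eq: "real_of_int \<bar>j\<^sup>2 - i\<^sup>2\<bar> = sg i j * ((of_int j)\<^sup>2 - (of_int i)\<^sup>2)"
      by (simp add: sg_def abs_sgn mult.commute)
    have "of_int \<bar>j\<^sup>2 - i\<^sup>2\<bar> * bc n i * bc m j
        = sg i j * bc n i * ((of_int j)\<^sup>2 * bc m j) - sg i j * bc m j * ((of_int i)\<^sup>2 * bc n i)"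
      unfolding abs_eq by (simp add: algebra_simps)
    also have "\<dots> = ((real m)\<^sup>2 - (real n)\<^sup>2) * (sg i j * bc n i * bc m j)
        - 2 * real m * (2 * real m - 1) * (sg i j * bc n i * bc (m - 1) j)
        + 2 * real n * (2 * real n - 1) * (sg i j * bc (n - 1) i * bc m j)"
      unfolding square_times_bc by (simp add: algebra_simps)
    finally show ?thesis .
  qed
  then show ?thesis
    unfolding abs_sum_def sgn_sum_def by (simp only: sum.distrib sum_subtractf sum_distrib_left)
qed

text \<open>After elimination of the lower sign sums, the coefficient of
  \<open>sgn_sum N n m\<close> collapses to \<open>(m - n) / 2\<close>.\<close>

lemma abs_sum_eq:
  assumes "n \<le> N" "m \<le> N"
  shows "abs_sum N n m = 2 * real n * real m * bc n 0 * bc m 0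
    + (real m - real n) * sgn_sum N n m / 2
    + bc n 0 * bc m 0 * ((real m - real n)\<^sup>2 / (2 * real (m + n)))"
proof (cases "m + n = 0")
  \<comment> \<open>Here the denominator \<open>m + n\<close> is 0 and the quotient counts as 0; all
    terms vanish.\<close>
  case True
  then show ?thesis using abs_sum_eq_sgn_sums[of N n m] by simp
next
  case False
  let ?S = "sgn_sum N n m" and ?P = "bc n 0 * bc m 0" and ?s = "real (m + n)"
  have "bc m 0 * bc n 0 * (real n * real m * (2 * real n - 1) / real (n + m) + real n / 2)
      = ?P * (real m * real n * (2 * real n - 1) / ?s + real n / 2)"
    by (simp add: mult_ac add_ac)
  \<comment> \<open>This is \<open>sgn_sum_pred\<close> with \<open>m\<close> and \<open>n\<close>
    exchanged; antisymmetry of both sign sums turns its minus into a plus.\<close>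
  then have pred_n: "2 * real n * (2 * real n - 1) * sgn_sum N (n - 1) m
      = real n * (2 * real n - 1) / 2 * ?S
        + ?P * (real m * real n * (2 * real n - 1) / ?s + real n / 2)"
    using sgn_sum_pred[OF assms] sgn_sum_antisym[of N m n] sgn_sum_antisym[of N m "n - 1"]
    by (simp only: mult_minus_right)
  have "abs_sum N n m = (real m - real n) * ?S / 2
      + ?P * (real m * real n * (2 * real m - 1) / ?s + real m / 2
              + real m * real n * (2 * real n - 1) / ?s + real n / 2)"
    unfolding abs_sum_eq_sgn_sums sgn_sum_pred[OF assms(2,1)] pred_n
    by (simp add: power2_eq_square algebra_simps add_divide_distrib diff_divide_distrib)
  \<comment> \<open>With \<open>s = m + n\<close> the left side is
    \<open>2 m n - 2 m n / s + s / 2\<close>, and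
    \<open>s\<^sup>2 - 4 m n = (m - n)\<^sup>2\<close>.\<close>
  also have "real m * real n * (2 * real m - 1) / ?s + real m / 2
              + real m * real n * (2 * real n - 1) / ?s + real n / 2
      = 2 * real n * real m + (real m - real n)\<^sup>2 / (2 * ?s)"
  proof -
    have "real m + real n \<noteq> 0" using False by linarith
    then show ?thesis by (simp add: divide_simps) (simp add: algebra_simps power2_eq_square)
  qed
  finally show ?thesis by (simp add: algebra_simps)
qed

text \<open>The support lies in the window, so \<open>Sum_any\<close> is an ordinary finite
  sum.\<close>

lemma Sum_any_eq_abs_sum:
  assumes "n \<le> N" "m \<le> N"
  shows "real_of_int (\<Sum>(i, j). \<bar>j^2 - i^2\<bar> * int (2 * n ichoose (int n + i))
                                  * int (2 * m ichoose (int m + j))) = abs_sum N n m"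
proof -
  let ?A = "{- int N..int N}"
  let ?g = "\<lambda>(i, j). \<bar>j^2 - i^2\<bar> * int (2 * n ichoose (int n + i)) * int (2 * m ichoose (int m + j))"
  have "{p. ?g p \<noteq> 0} \<subseteq> ?A \<times> ?A"
    using assms by (auto simp: ichoose_def binomial_eq_0_iff split: if_splits)
  then have "Sum_any ?g = sum ?g (?A \<times> ?A)"
    by (intro Sum_any.expand_superset) auto
  then show ?thesis
    by (simp add: abs_sum_def bc_def sum.cartesian_product case_prod_beta)
qed

theorem theorem7p1:
  fixes m n :: nat
  shows "(\<Sum>(i, j). \<bar>j^2 - i^2\<bar> * int (2 * n ichoose (int n + i))
                                  * int (2 * m ichoose (int m + j)))
           \<ge> 2 * int n * int m * int (2 * n choose n) * int (2 * m choose m)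
       \<and> ((\<Sum>(i, j). \<bar>j^2 - i^2\<bar> * int (2 * n ichoose (int n + i))
                                  * int (2 * m ichoose (int m + j)))
           = 2 * int n * int m * int (2 * n choose n) * int (2 * m choose m)
          \<longleftrightarrow> m = n)"
    (is "?F \<ge> ?R \<and> (?F = ?R \<longleftrightarrow> m = n)")
proof -
  define N where "N = max m n"
  let ?E = "bc n 0 * bc m 0 * ((real m - real n)\<^sup>2 / (2 * real (m + n)))"
  have R: "real_of_int ?R = 2 * real n * real m * bc n 0 * bc m 0"
    by (simp add: bc_0)
  have N: "n \<le> N" "m \<le> N" by (auto simp: N_def)
  have F: "real_of_int ?F = real_of_int ?R + (real m - real n) * sgn_sum N n m / 2 + ?E"
    unfolding Sum_any_eq_abs_sum[OF N] R by (rule abs_sum_eq[OF N])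
  show ?thesis
  proof (cases "m = n")
    case True
    then have "real_of_int ?F = real_of_int ?R" using F by simp
    then have "?F = ?R" by (simp only: of_int_eq_iff)
    then show ?thesis using True by simp
  next
    case False
    \<comment> \<open>Strictness comes from \<open>?E\<close> alone; the sign sum term is only known
      to be nonnegative.\<close>
    then have "?E > 0"
      using bc_0_pos[of n] bc_0_pos[of m] by (intro mult_pos_pos divide_pos_pos) auto
    then have "real_of_int ?R < real_of_int ?F"
      using F diff_mult_sgn_sum_nonneg[OF N] by linarith
    then have "?R < ?F" by (simp only: of_int_less_iff)
    then show ?thesis using False by simp
  qed
qed

end
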